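(* Let $Y=\{-1,1\}$, let $\sigma_-,\sigma_+\ge 0$ with $\sigma_-+\sigma_+<1$, and let $\ell:Y\times\mathbb{R}\to\mathbb{R}$ be a (measurable) loss for which there is a constant $C$ with $$\sigma_+\,\ell(-1,v)+\sigma_-\,\ell(1,v)=C\qquad\text{for all }v\in\mathbb{R}.$$ Then the losses $\ell_{\sigma_-,\sigma_+}$ and $\ell$ are order equivalent.
   Context: With the notation $\sigma_{1}=\sigma_+$ and $\sigma_{-1}=\sigma_-$ (the probabilities with which a label $+1$, respectively $-1$, is flipped), the corrected loss is $$\ell_{\sigma_-,\sigma_+}(y,v)=\frac{(1-\sigma_{-y})\,\ell(y,v)-\sigma_y\,\ell(-y,v)}{1-\sigma_{-1}-\sigma_1}.$$ For a loss $\ell$ and probability distributions $Q,Q'$ on $\mathbb{R}\times Y$ (over score–label pairs $(v,y)$), write $Q\le_\ell Q'$ if $\mathbb{E}_{(v,y)\sim Q}\ell(y,v)\le\mathbb{E}_{(v,y)\sim Q'}\ell(y,v)$. Losses $\ell_1,\ell_2$ are order equivalent if for all distributions $Q,Q'$ on $\mathbb{R}\times Y$, $Q\le_{\ell_1}Q'\Leftrightarrow Q\le_{\ell_2}Q'$. Here $Q,Q'$ range over distributions under which $\ell(1,v)$ and $\ell(-1,v)$ are both integrable. *)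

theory Defs
  imports "HOL-Probability.Probability"
begin

text \<open>A loss is a function of a label and a score. Labels are integers so that \<open>-y\<close> is
  available; everything below looks at a loss only at the labels in \<open>Y = {-1, 1}\<close>, its values
  at other integers being irrelevant.\<close>

type_synonym loss = "int \<Rightarrow> real \<Rightarrow> real"

definition labels :: "int set" where
  "labels = {-1, 1}"

text \<open>\<open>flip_prob \<sigma>m \<sigma>p y\<close> is \<open>\<sigma>\<^sub>y\<close>, with \<open>\<sigma>m = \<sigma>\<^sub>-\<close> and \<open>\<sigma>p = \<sigma>\<^sub>+\<close>.\<close>

definition flip_prob :: "real \<Rightarrow> real \<Rightarrow> int \<Rightarrow> real" where
  "flip_prob \<sigma>m \<sigma>p y = (if y = 1 then \<sigma>p else \<sigma>m)"

definition corrected_loss :: "real \<Rightarrow> real \<Rightarrow> loss \<Rightarrow> loss" where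
  "corrected_loss \<sigma>m \<sigma>p l y v =
     ((1 - flip_prob \<sigma>m \<sigma>p (-y)) * l y v - flip_prob \<sigma>m \<sigma>p y * l (-y) v) /
     (1 - flip_prob \<sigma>m \<sigma>p (-1) - flip_prob \<sigma>m \<sigma>p 1)"

definition measurable_loss :: "loss \<Rightarrow> bool" where
  "measurable_loss l \<longleftrightarrow>
     (\<lambda>(y, v). l y v) \<in> borel_measurable (count_space labels \<Otimes>\<^sub>M borel)"

definition score_label_distributions :: "(real \<times> int) measure set" where
  "score_label_distributions =
     {Q. prob_space Q \<and> sets Q = sets (borel \<Otimes>\<^sub>M count_space labels)}"

definition integrable_distributions :: "loss \<Rightarrow> (real \<times> int) measure set" where
  "integrable_distributions l =
     {Q \<in> score_label_distributions. \<forall>y'\<in>labels. integrable Q (\<lambda>(v, y). l y' v)}"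

definition loss_le :: "loss \<Rightarrow> (real \<times> int) measure \<Rightarrow> (real \<times> int) measure \<Rightarrow> bool" where
  "loss_le l Q Q' \<longleftrightarrow> (\<integral>(v, y). l y v \<partial>Q) \<le> (\<integral>(v, y). l y v \<partial>Q')"

text \<open>The Bochner integral of a non-integrable function is \<open>0\<close>, so order equivalence is
  relative to a class \<open>D\<close> of distributions, which has to be chosen such that the
  expectations of both losses exist.\<close>

definition order_equivalent_on :: "(real \<times> int) measure set \<Rightarrow> loss \<Rightarrow> loss \<Rightarrow> bool" where
  "order_equivalent_on D l1 l2 \<longleftrightarrow>
     (\<forall>Q\<in>D. \<forall>Q'\<in>D. loss_le l1 Q Q' \<longleftrightarrow> loss_le l2 Q Q')"

end

theory Submission
  imports Defs
begin

text \<open>The hypothesis turns the numerator of the corrected loss into \<open>l y v - C\<close>, so on the labels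
  the corrected loss is a positive affine function of \<open>l\<close>, and so is its expectation.\<close>

lemma corrected_loss_affine:
  assumes "\<sigma>p * l (-1) v + \<sigma>m * l 1 v = C" and "y \<in> labels"
  shows "corrected_loss \<sigma>m \<sigma>p l y v = (l y v - C) / (1 - \<sigma>m - \<sigma>p)"
  using assms by (auto simp: corrected_loss_def flip_prob_def labels_def algebra_simps)

text \<open>Every point of \<open>Q\<close> carries a label in Y, so facts about \<open>l\<close>
  that hold only at the labels -1 and 1 can be used pointwise, without an exceptional null
  set.\<close>

lemma space_score_label_distribution:
  assumes "Q \<in> score_label_distributions"
  shows "space Q = UNIV \<times> labels"
  using assms sets_eq_imp_space_eq[of Q "borel \<Otimes>\<^sub>M count_space labels"]
  by (auto simp: score_label_distributions_def space_pair_measure)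

text \<open>\<open>integrable_distributions\<close> speaks of a fixed label only. When the label
  varies with the point, |l(1,v)| + |l(-1,v)| still dominates the loss.\<close>

lemma integrable_loss:
  assumes "measurable_loss l" and Q: "Q \<in> integrable_distributions l"
  shows "integrable Q (\<lambda>(v, y). l y v)"
proof (rule Bochner_Integration.integrable_bound)
  have D: "Q \<in> score_label_distributions"
    and int: "\<And>y'. y' \<in> labels \<Longrightarrow> integrable Q (\<lambda>(v, y). l y' v)"
    using Q by (auto simp: integrable_distributions_def)
  show "integrable Q (\<lambda>z. \<bar>l 1 (fst z)\<bar> + \<bar>l (-1) (fst z)\<bar>)"
    using int[of 1] int[of "-1"]
    by (intro Bochner_Integration.integrable_add integrable_abs)
      (simp_all add: labels_def case_prod_beta')
  \<comment> \<open>\<open>measurable_loss\<close> puts the label first, the distributions put the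
    score first, hence the swap.\<close>
  have "(\<lambda>(v, y). l y v) \<in> borel_measurable (borel \<Otimes>\<^sub>M count_space labels)"
    using measurable_pair_swap[OF assms(1)[unfolded measurable_loss_def]] by (simp add: case_prod_beta)
  moreover have "sets Q = sets (borel \<Otimes>\<^sub>M count_space labels)"
    using D by (simp add: score_label_distributions_def)
  ultimately show "(\<lambda>(v, y). l y v) \<in> borel_measurable Q"
    using measurable_cong_sets by blast
  show "AE z in Q. norm (case z of (v, y) \<Rightarrow> l y v) \<le> norm (\<bar>l 1 (fst z)\<bar> + \<bar>l (-1) (fst z)\<bar>)"
    using space_score_label_distribution[OF D] by (intro AE_I2) (auto simp: labels_def)
qed

lemma expectation_corrected_loss:
  assumes "measurable_loss l" and Q: "Q \<in> integrable_distributions l"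
    and C: "\<And>v. \<sigma>p * l (-1) v + \<sigma>m * l 1 v = C"
  shows "(\<integral>(v, y). corrected_loss \<sigma>m \<sigma>p l y v \<partial>Q) = ((\<integral>(v, y). l y v \<partial>Q) - C) / (1 - \<sigma>m - \<sigma>p)"
proof -
  have D: "Q \<in> score_label_distributions"
    using Q by (simp add: integrable_distributions_def)
  then interpret prob_space Q
    by (simp add: score_label_distributions_def)
  have "(\<integral>(v, y). corrected_loss \<sigma>m \<sigma>p l y v \<partial>Q)
      = (\<integral>z. ((case z of (v, y) \<Rightarrow> l y v) - C) / (1 - \<sigma>m - \<sigma>p) \<partial>Q)"
    \<comment> \<open>The affine formula is available only for y in \<open>labels\<close>, so the
      integrands are compared on the space of \<open>Q\<close>.\<close>
    using space_score_label_distribution[OF D]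
    by (intro Bochner_Integration.integral_cong) (auto simp: corrected_loss_affine[OF C])
  also have "\<dots> = ((\<integral>(v, y). l y v \<partial>Q) - C) / (1 - \<sigma>m - \<sigma>p)"
    \<comment> \<open>Integrability allows splitting the integral of the difference; the constant C
      integrates to itself because \<open>Q\<close> has total mass 1.\<close>
    using integrable_loss[OF assms(1) Q]
    by (simp add: Bochner_Integration.integral_diff prob_space)
  finally show ?thesis .
qed

theorem theorem17:
  fixes \<sigma>m \<sigma>p C :: real and l :: loss
  assumes "\<sigma>m \<ge> 0" and "\<sigma>p \<ge> 0" and "\<sigma>m + \<sigma>p < 1"
    and "measurable_loss l"
    and "\<And>v. \<sigma>p * l (-1) v + \<sigma>m * l 1 v = C"
  shows "order_equivalent_on (integrable_distributions l) (corrected_loss \<sigma>m \<sigma>p l) l"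
  \<comment> \<open>Both expectations undergo the same shift by C and the same division by 1 -
    \<sigma>m - \<sigma>p > 0, which preserves and reflects \<le>.\<close>
  using assms(3) expectation_corrected_loss[OF assms(4) _ assms(5)]
  by (simp add: order_equivalent_on_def loss_le_def divide_le_cancel)

end
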